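(* Let $n\ge1$. There are no $\psi\in H(\mathbb{D}^n)$ and holomorphic self-map $\varphi$ of $\mathbb{D}^n$ such that the weighted composition operator $W_{\psi,\varphi}f=\psi\,(f\circ\varphi)$ is an isometry from $\mathcal{B}(\mathbb{D}^n)$ into $H^\infty(\mathbb{D}^n)$.
   Context: $\mathbb{D}^n=\{z\in\mathbb{C}^n:|z_k|<1,\ k=1,\dots,n\}$. $H(\mathbb{D}^n)$ is the set of holomorphic functions $\mathbb{D}^n\to\mathbb{C}$, and $H^\infty(\mathbb{D}^n)$ is the space of bounded ones with the supremum norm $\|\cdot\|_\infty$. Bergman metric: $H_z(u,\overline{v})=\sum_{j=1}^n\frac{u_j\overline{v_j}}{(1-|z_j|^2)^2}$. For $f\in H(\mathbb{D}^n)$, let $Q_f(z)=\sup_{u\in\mathbb{C}^n\setminus\{0\}}\frac{\left|\sum_{k=1}^n\frac{\partial f}{\partial z_k}(z)u_k\right|}{H_z(u,\overline{u})^{1/2}}$ and $\beta_f=\sup_{z\in\mathbb{D}^n}Q_f(z)$. The Bloch space $\mathcal{B}(\mathbb{D}^n)=\{f\in H(\mathbb{D}^n):\beta_f<\infty\}$ has norm $\|f\|_{\mathcal{B}}=|f(0)|+\beta_f$. A linear operator $T:\mathcal{B}(\mathbb{D}^n)\to H^\infty(\mathbb{D}^n)$ is an isometry if $\|Tf\|_\infty=\|f\|_{\mathcal{B}}$ for all $f\in\mathcal{B}(\mathbb{D}^n)$ (surjectivity is not required). *)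

theory Defs
  imports "HOL-Analysis.Analysis"
begin

text \<open>
  The dimension \<open>n \<ge> 1\<close> is the cardinality of the index type \<open>'n::finite\<close>. Functions on the
  polydisc are total functions on \<open>complex^'n\<close>; every notion below depends only on their
  values on the polydisc.
\<close>

definition polydisc :: "(complex^'n) set" where
  "polydisc = {z. \<forall>k. cmod (z $ k) < 1}"

text \<open>
  Holomorphy in several variables is complex Frechet differentiability; \<open>has_derivative\<close>
  itself only asks for real linearity. It is used for open \<open>S\<close> only.
\<close>

definition holomorphic_Cn :: "(complex^'n \<Rightarrow> complex) \<Rightarrow> (complex^'n) set \<Rightarrow> bool" where
  "holomorphic_Cn f S \<longleftrightarrow>
     (\<forall>z\<in>S. \<exists>L. (f has_derivative L) (at z) \<and> (\<forall>c v. L (c *s v) = c * L v))"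

definition H_space :: "(complex^'n \<Rightarrow> complex) set" where
  "H_space = {f. holomorphic_Cn f polydisc}"

definition Hinf_space :: "(complex^'n \<Rightarrow> complex) set" where
  "Hinf_space = {f \<in> H_space. bounded (f ` polydisc)}"

definition sup_norm :: "(complex^'n \<Rightarrow> complex) \<Rightarrow> ereal" where
  "sup_norm f = (SUP z\<in>polydisc. ereal (cmod (f z)))"

definition holomorphic_self_map :: "(complex^'n \<Rightarrow> complex^'n) \<Rightarrow> bool" where
  "holomorphic_self_map \<phi> \<longleftrightarrow>
     (\<forall>k. (\<lambda>z. \<phi> z $ k) \<in> H_space) \<and> \<phi> ` polydisc \<subseteq> polydisc"

definition partial_deriv :: "'n \<Rightarrow> (complex^'n \<Rightarrow> complex) \<Rightarrow> complex^'n \<Rightarrow> complex" where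
  "partial_deriv k f z = deriv (\<lambda>w. f (\<chi> j. if j = k then w else z $ j)) (z $ k)"

text \<open>\<open>bergman z u v\<close> is \<open>H\<^sub>z(u, cnj v)\<close>: the conjugation of \<open>v\<close> is part of the definition.\<close>

definition bergman :: "complex^'n \<Rightarrow> complex^'n \<Rightarrow> complex^'n \<Rightarrow> complex" where
  "bergman z u v = (\<Sum>j\<in>UNIV. u $ j * cnj (v $ j) / complex_of_real ((1 - (cmod (z $ j))\<^sup>2)\<^sup>2))"

text \<open>\<open>bergman z u u\<close> is real and nonnegative, so taking \<open>Re\<close> loses nothing.\<close>

definition bloch_Q :: "(complex^'n \<Rightarrow> complex) \<Rightarrow> complex^'n \<Rightarrow> ereal" where
  "bloch_Q f z =
     (SUP u\<in>UNIV - {0}. ereal (cmod (\<Sum>k\<in>UNIV. partial_deriv k f z * u $ k) / sqrt (Re (bergman z u u))))"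

definition bloch_seminorm :: "(complex^'n \<Rightarrow> complex) \<Rightarrow> ereal" where
  "bloch_seminorm f = (SUP z\<in>polydisc. bloch_Q f z)"

definition bloch_space :: "(complex^'n \<Rightarrow> complex) set" where
  "bloch_space = {f \<in> H_space. bloch_seminorm f < \<infinity>}"

definition bloch_norm :: "(complex^'n \<Rightarrow> complex) \<Rightarrow> ereal" where
  "bloch_norm f = ereal (cmod (f 0)) + bloch_seminorm f"

definition weighted_comp ::
  "(complex^'n \<Rightarrow> complex) \<Rightarrow> (complex^'n \<Rightarrow> complex^'n) \<Rightarrow> (complex^'n \<Rightarrow> complex) \<Rightarrow> complex^'n \<Rightarrow> complex"
  where "weighted_comp \<psi> \<phi> f = (\<lambda>z. \<psi> z * (f \<circ> \<phi>) z)"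

lemma weighted_comp_linear:
  "weighted_comp \<psi> \<phi> (\<lambda>z. a * f z + b * g z) =
     (\<lambda>z. a * weighted_comp \<psi> \<phi> f z + b * weighted_comp \<psi> \<phi> g z)"
  by (simp add: weighted_comp_def fun_eq_iff algebra_simps)

text \<open>
  Linearity of \<open>T\<close> is not part of this predicate; for \<open>weighted_comp \<psi> \<phi>\<close> it is the lemma above.
  Surjectivity is not required.
\<close>

definition isometry_Bloch_Hinf ::
  "((complex^'n \<Rightarrow> complex) \<Rightarrow> complex^'n \<Rightarrow> complex) \<Rightarrow> bool" where
  "isometry_Bloch_Hinf T \<longleftrightarrow>
     (\<forall>f\<in>bloch_space. T f \<in> Hinf_space \<and> sup_norm (T f) = bloch_norm f)"

end

theory Submission
  imports Defs
begin

text \<open>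
  Test the isometry on \<open>1\<close>, \<open>z\<^sub>k\<close> and \<open>z\<^sub>k\<^sup>2\<close>, of Bloch norm \<open>1\<close>, \<open>1\<close> and
  \<open>4 / (3 \<surd>3) < 9/10\<close>. The first and the third give \<open>\<bar>\<psi>\<bar> \<le> 1\<close> and \<open>\<bar>\<psi> \<phi>\<^sub>k\<^sup>2\<bar> \<le> 9/10\<close>, hence
  \<open>\<bar>\<psi> \<phi>\<^sub>k\<bar>\<^sup>2 = \<bar>\<psi>\<bar> \<bar>\<psi> \<phi>\<^sub>k\<^sup>2\<bar> \<le> 9/10\<close>, so \<open>\<psi> \<phi>\<^sub>k\<close> cannot have supremum norm \<open>1\<close>.
\<close>

text \<open>All three test functions are \<open>g (z $ k)\<close> for an entire \<open>g\<close>, so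
  the chain rule for this shape covers them at once.\<close>

lemma H_space_coordinate:
  fixes g :: "complex \<Rightarrow> complex"
  assumes "\<And>w. (g has_field_derivative g' w) (at w)"
  shows "(\<lambda>z::complex^'n. g (z $ k)) \<in> H_space"
  unfolding H_space_def holomorphic_Cn_def mem_Collect_eq
proof
  fix z :: "complex^'n"
  have "((\<lambda>z::complex^'n. z $ k) has_derivative (\<lambda>h. h $ k)) (at z)"
    by (rule bounded_linear.has_derivative[OF bounded_linear_vec_nth]) (rule has_derivative_ident)
  moreover have "(g has_derivative (\<lambda>h. g' (z $ k) * h)) (at (z $ k))"
    using assms by (simp add: has_field_derivative_def)
  ultimately have "((\<lambda>z. g (z $ k)) has_derivative (\<lambda>h. g' (z $ k) * h $ k)) (at z)"
    by (rule has_derivative_compose)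
  then show "\<exists>L. ((\<lambda>z. g (z $ k)) has_derivative L) (at z) \<and> (\<forall>c v. L (c *s v) = c * L v)"
    by (intro exI[of _ "\<lambda>h. g' (z $ k) * h $ k"]) simp
qed

lemma partial_deriv_coordinate:
  assumes "\<And>w. (g has_field_derivative g' w) (at w)"
  shows "partial_deriv j (\<lambda>z. g (z $ k)) z = (if j = k then g' (z $ k) else 0)"
  using assms by (auto simp: partial_deriv_def intro: DERIV_imp_deriv)

lemma gradient_coordinate:
  fixes z u :: "complex^'n"
  assumes "\<And>w. (g has_field_derivative g' w) (at w)"
  shows "(\<Sum>j\<in>UNIV. partial_deriv j (\<lambda>z. g (z $ k)) z * u $ j) = g' (z $ k) * u $ k"
  by (simp add: partial_deriv_coordinate[OF assms] if_distrib[of "\<lambda>x. x * _"] cong: if_cong)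

text \<open>With every summand written as a square, nonnegativity and lower bounds by a single
  summand become immediate.\<close>

lemma Re_bergman:
  "Re (bergman z u u) = (\<Sum>j\<in>UNIV. (cmod (u $ j) / (1 - (cmod (z $ j))\<^sup>2))\<^sup>2)"
proof -
  have "Re (u $ j * cnj (u $ j) / complex_of_real ((1 - (cmod (z $ j))\<^sup>2)\<^sup>2))
      = (cmod (u $ j) / (1 - (cmod (z $ j))\<^sup>2))\<^sup>2" for j
    by (simp only: complex_norm_square[symmetric] of_real_divide[symmetric] Re_complex_of_real
        power_divide)
  then show ?thesis by (simp add: bergman_def)
qed

lemma polydisc_coordinate: "z \<in> polydisc \<Longrightarrow> 0 < 1 - (cmod (z $ k))\<^sup>2"
  by (simp add: polydisc_def abs_square_less_1)

lemma bergman_ge_coordinate: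
  "cmod (u $ k) / (1 - (cmod (z $ k))\<^sup>2) \<le> sqrt (Re (bergman z u u))"
  unfolding Re_bergman
  by (rule real_le_rsqrt) (rule member_le_sum, auto)

text \<open>The gradient sees only \<open>u $ k\<close>, and the Bergman length of \<open>u\<close>
  is at least its \<open>k\<close>-th contribution. So the quotient is at most the one-variable
  Bloch quantity of \<open>g\<close>.\<close>

lemma bloch_Q_coordinate_le:
  fixes z :: "complex^'n"
  assumes g: "\<And>w. (g has_field_derivative g' w) (at w)" and z: "z \<in> polydisc"
  shows "bloch_Q (\<lambda>z. g (z $ k)) z \<le> ereal (cmod (g' (z $ k)) * (1 - (cmod (z $ k))\<^sup>2))"
  unfolding bloch_Q_def gradient_coordinate[OF g]
proof (rule SUP_least, unfold ereal_less_eq)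
  fix u :: "complex^'n"
  let ?s = "sqrt (Re (bergman z u u))"
  have s: "0 \<le> ?s" by (simp add: Re_bergman sum_nonneg)
  have "cmod (u $ k) \<le> (1 - (cmod (z $ k))\<^sup>2) * ?s"
    using bergman_ge_coordinate[of u k z] polydisc_coordinate[OF z, of k]
    by (simp add: field_simps)
  then have "cmod (g' (z $ k) * u $ k) \<le> cmod (g' (z $ k)) * (1 - (cmod (z $ k))\<^sup>2) * ?s"
    by (simp add: norm_mult mult.assoc mult_left_mono)
  moreover have "0 \<le> cmod (g' (z $ k)) * (1 - (cmod (z $ k))\<^sup>2)"
    using polydisc_coordinate[OF z, of k] by simp
  ultimately show "cmod (g' (z $ k) * u $ k) / ?s \<le> cmod (g' (z $ k)) * (1 - (cmod (z $ k))\<^sup>2)"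
    \<comment> \<open>If \<open>?s = 0\<close>, the quotient is 0 by the convention for division by
      zero.\<close>
    using s by (cases "?s = 0") (simp_all add: divide_le_eq)
qed

lemma bloch_seminorm_coordinate_le:
  assumes g: "\<And>w. (g has_field_derivative g' w) (at w)"
    and C: "\<And>w. cmod w < 1 \<Longrightarrow> cmod (g' w) * (1 - (cmod w)\<^sup>2) \<le> C"
  shows "bloch_seminorm (\<lambda>z::complex^'n. g (z $ k)) \<le> ereal C"
  unfolding bloch_seminorm_def
proof (rule SUP_least)
  fix z :: "complex^'n" assume z: "z \<in> polydisc"
  then have "cmod (z $ k) < 1" by (simp add: polydisc_def)
  with bloch_Q_coordinate_le[OF g z, of k] C
  show "bloch_Q (\<lambda>z. g (z $ k)) z \<le> ereal C"
    by (meson ereal_less_eq(3) order_trans)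
qed

lemma bloch_space_coordinate:
  assumes g: "\<And>w. (g has_field_derivative g' w) (at w)"
    and C: "\<And>w. cmod w < 1 \<Longrightarrow> cmod (g' w) * (1 - (cmod w)\<^sup>2) \<le> C"
  shows "(\<lambda>z::complex^'n. g (z $ k)) \<in> bloch_space"
  using H_space_coordinate[OF g] bloch_seminorm_coordinate_le[OF g C, of k]
  by (auto simp: bloch_space_def intro: le_less_trans)

text \<open>At the origin the Bergman metric is Euclidean, and the direction \<open>axis k 1\<close>
  gives the quotient exactly 1.\<close>

lemma bloch_seminorm_coordinate_ge: "1 \<le> bloch_seminorm (\<lambda>z::complex^'n. z $ k)"
proof -
  have Re: "Re (bergman 0 (axis k 1) (axis k 1 :: complex^'n)) = 1"
  proof -
    have "(cmod ((axis k 1 :: complex^'n) $ j))\<^sup>2 = (if j = k then 1 else 0)" for j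
      by (simp add: axis_def)
    then show ?thesis by (simp add: Re_bergman)
  qed
  have "(1::ereal) = ereal (cmod (\<Sum>j\<in>UNIV. partial_deriv j (\<lambda>z. z $ k) 0 * (axis k 1 :: complex^'n) $ j)
      / sqrt (Re (bergman 0 (axis k 1) (axis k 1 :: complex^'n))))"
    unfolding gradient_coordinate[of "\<lambda>w. w" "\<lambda>_. 1", OF DERIV_ident] Re by simp
  also have "\<dots> \<le> bloch_Q (\<lambda>z. z $ k) (0 :: complex^'n)"
    unfolding bloch_Q_def by (rule SUP_upper) (simp add: axis_eq_0_iff)
  also have "\<dots> \<le> bloch_seminorm (\<lambda>z::complex^'n. z $ k)"
    unfolding bloch_seminorm_def by (rule SUP_upper) (simp add: polydisc_def)
  finally show ?thesis .
qed

lemma cubic_bound: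
  fixes r :: real
  assumes "0 \<le> r"
  shows "2 * r * (1 - r\<^sup>2) \<le> 9/10"
proof -
  \<comment> \<open>The maximum lies at 1/sqrt 3, and a = 3/5 is a rational approximation to it. The
    identity (r - a)^2 (r + 2a) = r^3 - 3 a^2 r + 2 a^3 then gives the bound 108/125 - 4r/25, which
    is below 9/10 for r \<ge> 0.\<close>
  have "0 \<le> 2 * ((r - 3/5)\<^sup>2 * (r + 6/5))" using assms by simp
  also have "\<dots> = 2 * r^3 - 54/25 * r + 108/125"
    by (simp add: power2_eq_square power3_eq_cube field_simps)
  finally show ?thesis using assms by (simp add: power2_eq_square power3_eq_cube algebra_simps)
qed

lemma isometry_norm_le:
  assumes "isometry_Bloch_Hinf (weighted_comp \<psi> \<phi>)" "f \<in> bloch_space"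
    and "bloch_norm f \<le> ereal C" "z \<in> polydisc"
  shows "cmod (\<psi> z * f (\<phi> z)) \<le> C"
proof -
  have "ereal (cmod (weighted_comp \<psi> \<phi> f z)) \<le> sup_norm (weighted_comp \<psi> \<phi> f)"
    unfolding sup_norm_def using assms(4) by (rule SUP_upper)
  also have "\<dots> \<le> ereal C" using assms(1-3) by (simp add: isometry_Bloch_Hinf_def)
  finally show ?thesis by (simp add: weighted_comp_def)
qed

theorem theorem6p6:
  "\<not> (\<exists>(\<psi> :: complex^'n \<Rightarrow> complex) (\<phi> :: complex^'n \<Rightarrow> complex^'n).
        \<psi> \<in> H_space \<and> holomorphic_self_map \<phi> \<and>
        isometry_Bloch_Hinf (weighted_comp \<psi> \<phi>))"
proof
  assume "\<exists>(\<psi> :: complex^'n \<Rightarrow> complex) (\<phi> :: complex^'n \<Rightarrow> complex^'n).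
        \<psi> \<in> H_space \<and> holomorphic_self_map \<phi> \<and> isometry_Bloch_Hinf (weighted_comp \<psi> \<phi>)"
  then obtain \<psi> :: "complex^'n \<Rightarrow> complex" and \<phi> :: "complex^'n \<Rightarrow> complex^'n"
    where iso: "isometry_Bloch_Hinf (weighted_comp \<psi> \<phi>)" by blast
  \<comment> \<open>Any coordinate will do; one exists because n \<ge> 1.\<close>
  fix k :: 'n
  have d0: "((\<lambda>w. 1::complex) has_field_derivative 0) (at w)" for w by simp
  have d1: "((\<lambda>w::complex. w) has_field_derivative 1) (at w)" for w by simp
  have d2: "((\<lambda>w::complex. w\<^sup>2) has_field_derivative 2 * w) (at w)" for w
    by (auto intro!: derivative_eq_intros)
  have b0: "cmod 0 * (1 - (cmod w)\<^sup>2) \<le> 0" for w by simp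
  have b1: "cmod 1 * (1 - (cmod w)\<^sup>2) \<le> 1" for w by simp
  have b2: "cmod (2 * w) * (1 - (cmod w)\<^sup>2) \<le> 9/10" for w
    using cubic_bound[of "cmod w"] by (simp add: norm_mult)
  have psi: "cmod (\<psi> z) \<le> 1" if "z \<in> polydisc" for z
  proof -
    have "bloch_norm (\<lambda>z::complex^'n. 1) \<le> ereal 1"
      \<comment> \<open>The constant 1 is treated as a function of the \<open>k\<close>-th
        coordinate with derivative 0, so only |f(0)| = 1 contributes to its norm.\<close>
      using add_left_mono[OF bloch_seminorm_coordinate_le[OF d0 b0, where 'n='n], where c=1]
      by (simp add: bloch_norm_def zero_ereal_def one_ereal_def)
    from isometry_norm_le[OF iso bloch_space_coordinate[OF d0 b0] this that] show ?thesis by simp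
  qed
  have psi2: "cmod (\<psi> z * (\<phi> z $ k)\<^sup>2) \<le> 9/10" if "z \<in> polydisc" for z
  proof -
    have "bloch_norm (\<lambda>z::complex^'n. (z $ k)\<^sup>2) \<le> ereal (9/10)"
      using bloch_seminorm_coordinate_le[OF d2 b2, where 'n='n] by (simp add: bloch_norm_def)
    from isometry_norm_le[OF iso bloch_space_coordinate[OF d2 b2] this that] show ?thesis .
  qed
  have "cmod (\<psi> z * \<phi> z $ k) \<le> sqrt (9/10)" if "z \<in> polydisc" for z
  proof (rule real_le_rsqrt)
    have "(cmod (\<psi> z * \<phi> z $ k))\<^sup>2 = cmod (\<psi> z) * cmod (\<psi> z * (\<phi> z $ k)\<^sup>2)"
      by (simp add: norm_mult norm_power power2_eq_square)
    also have "\<dots> \<le> 1 * (9/10)" using psi psi2 that by (intro mult_mono) auto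
    finally show "(cmod (\<psi> z * \<phi> z $ k))\<^sup>2 \<le> 9/10" by simp
  qed
  \<comment> \<open>The uniform constant matters: a pointwise bound < 1 would still allow the
    supremum to be 1.\<close>
  then have "sup_norm (weighted_comp \<psi> \<phi> (\<lambda>z. z $ k)) \<le> ereal (sqrt (9/10))"
    unfolding sup_norm_def by (intro SUP_least) (simp add: weighted_comp_def)
  also have "\<dots> < 1" by (simp add: one_ereal_def)
  also have "1 \<le> bloch_norm (\<lambda>z::complex^'n. z $ k)"
    using bloch_seminorm_coordinate_ge[of k] by (simp add: bloch_norm_def)
  also have "\<dots> = sup_norm (weighted_comp \<psi> \<phi> (\<lambda>z. z $ k))"
    using iso bloch_space_coordinate[OF d1 b1, of k] by (metis isometry_Bloch_Hinf_def)
  finally show False by simp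
qed

end
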